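(* Let $\Omega$ be an infinite set, $S=\mathrm{Sym}(\Omega)$ the group of all permutations of $\Omega$, $x$ any element of $\Omega$, and $B\subseteq S$ the stabilizer of $x$ in $S$. Then $S$ has no subgroup containing $B$ and isomorphic over $B$ to $S\amalg_B S$, the coproduct (free product) with amalgamation of $B$ of two copies of $S$.
   Context: $S\amalg_B S$ is the pushout, in the category of groups, of two copies of the inclusion $B\to S$; $B$ is regarded as a subgroup of it via the common composite map. "Isomorphic over $B$" means isomorphic by an isomorphism that restricts to the identity on $B$. *)

theory Defs
  imports "HOL-Algebra.Group_Action"
begin

text \<open>
  The pushout of \<open>f : C \<rightarrow> G\<close> and \<open>g : C \<rightarrow> H\<close> in the category of groups is constructed as the
  set of words in the disjoint union of the two carriers, modulo the least monoid congruence
  that makes both copies multiplicative and unital and identifies \<open>f c\<close> with \<open>g c\<close>.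
  Inverses come for free because \<open>G\<close> and \<open>H\<close> are groups.  The theorem \<open>pushout_universal\<close> below
  is the defining universal property, with the target group over an arbitrary type.
\<close>

definition pushout_words ::
  "('g, 'm) monoid_scheme \<Rightarrow> ('h, 'n) monoid_scheme \<Rightarrow> ('g + 'h) list set"
  where "pushout_words G H = lists (carrier G <+> carrier H)"

inductive pushout_eq ::
  "('c, 'k) monoid_scheme \<Rightarrow> ('g, 'm) monoid_scheme \<Rightarrow> ('h, 'n) monoid_scheme \<Rightarrow>
   ('c \<Rightarrow> 'g) \<Rightarrow> ('c \<Rightarrow> 'h) \<Rightarrow> ('g + 'h) list \<Rightarrow> ('g + 'h) list \<Rightarrow> bool"
  for C G H f g
where
  refl: "u \<in> pushout_words G H \<Longrightarrow> pushout_eq C G H f g u u"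
| sym: "pushout_eq C G H f g u v \<Longrightarrow> pushout_eq C G H f g v u"
| trans: "pushout_eq C G H f g u v \<Longrightarrow> pushout_eq C G H f g v w \<Longrightarrow> pushout_eq C G H f g u w"
| append: "pushout_eq C G H f g u u' \<Longrightarrow> pushout_eq C G H f g v v' \<Longrightarrow>
    pushout_eq C G H f g (u @ v) (u' @ v')"
| one_left: "pushout_eq C G H f g [Inl \<one>\<^bsub>G\<^esub>] []"
| one_right: "pushout_eq C G H f g [Inr \<one>\<^bsub>H\<^esub>] []"
| mult_left: "a \<in> carrier G \<Longrightarrow> a' \<in> carrier G \<Longrightarrow>
    pushout_eq C G H f g [Inl a, Inl a'] [Inl (a \<otimes>\<^bsub>G\<^esub> a')]"
| mult_right: "b \<in> carrier H \<Longrightarrow> b' \<in> carrier H \<Longrightarrow>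
    pushout_eq C G H f g [Inr b, Inr b'] [Inr (b \<otimes>\<^bsub>H\<^esub> b')]"
| glue: "c \<in> carrier C \<Longrightarrow> pushout_eq C G H f g [Inl (f c)] [Inr (g c)]"

definition pushout_class ::
  "('c, 'k) monoid_scheme \<Rightarrow> ('g, 'm) monoid_scheme \<Rightarrow> ('h, 'n) monoid_scheme \<Rightarrow>
   ('c \<Rightarrow> 'g) \<Rightarrow> ('c \<Rightarrow> 'h) \<Rightarrow> ('g + 'h) list \<Rightarrow> ('g + 'h) list set"
  where "pushout_class C G H f g u = {v. pushout_eq C G H f g u v}"

definition group_pushout ::
  "('c, 'k) monoid_scheme \<Rightarrow> ('g, 'm) monoid_scheme \<Rightarrow> ('h, 'n) monoid_scheme \<Rightarrow>
   ('c \<Rightarrow> 'g) \<Rightarrow> ('c \<Rightarrow> 'h) \<Rightarrow> ('g + 'h) list set monoid"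
  where "group_pushout C G H f g =
    \<lparr>carrier = pushout_class C G H f g ` pushout_words G H,
     mult = (\<lambda>X Y. \<Union>u\<in>X. \<Union>v\<in>Y. pushout_class C G H f g (u @ v)),
     one = pushout_class C G H f g []\<rparr>"

definition pushout_inl ::
  "('c, 'k) monoid_scheme \<Rightarrow> ('g, 'm) monoid_scheme \<Rightarrow> ('h, 'n) monoid_scheme \<Rightarrow>
   ('c \<Rightarrow> 'g) \<Rightarrow> ('c \<Rightarrow> 'h) \<Rightarrow> 'g \<Rightarrow> ('g + 'h) list set"
  where "pushout_inl C G H f g a = pushout_class C G H f g [Inl a]"

definition pushout_inr ::
  "('c, 'k) monoid_scheme \<Rightarrow> ('g, 'm) monoid_scheme \<Rightarrow> ('h, 'n) monoid_scheme \<Rightarrow>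
   ('c \<Rightarrow> 'g) \<Rightarrow> ('c \<Rightarrow> 'h) \<Rightarrow> 'h \<Rightarrow> ('g + 'h) list set"
  where "pushout_inr C G H f g b = pushout_class C G H f g [Inr b]"

locale group_pushout_data = C: group C + G: group G + H: group H
  for C :: "('c, 'k) monoid_scheme" and G :: "('g, 'm) monoid_scheme"
    and H :: "('h, 'n) monoid_scheme" +
  fixes f :: "'c \<Rightarrow> 'g" and g :: "'c \<Rightarrow> 'h"
  assumes f_hom: "f \<in> hom C G" and g_hom: "g \<in> hom C H"
begin

abbreviation "E \<equiv> pushout_eq C G H f g"
abbreviation "W \<equiv> pushout_words G H"
abbreviation "cls \<equiv> pushout_class C G H f g"
abbreviation "P \<equiv> group_pushout C G H f g"
abbreviation "inl \<equiv> pushout_inl C G H f g"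
abbreviation "inr \<equiv> pushout_inr C G H f g"

lemma f_closed: "c \<in> carrier C \<Longrightarrow> f c \<in> carrier G"
  using f_hom by (auto simp: hom_def)

lemma g_closed: "c \<in> carrier C \<Longrightarrow> g c \<in> carrier H"
  using g_hom by (auto simp: hom_def)

lemma pushout_eq_words: "E u v \<Longrightarrow> u \<in> W \<and> v \<in> W"
  by (induction rule: pushout_eq.induct)
    (auto simp: pushout_words_def f_closed g_closed)

lemma cls_eq_iff: "u \<in> W \<Longrightarrow> cls u = cls v \<longleftrightarrow> E u v"
proof
  assume "u \<in> W" "cls u = cls v"
  then show "E u v"
    by (metis pushout_eq.refl pushout_eq.sym mem_Collect_eq pushout_class_def)
next
  assume "E u v"
  then show "cls u = cls v"
    unfolding pushout_class_def by (blast intro: pushout_eq.sym pushout_eq.trans)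
qed

lemma cls_self: "u \<in> W \<Longrightarrow> u \<in> cls u"
  by (simp add: pushout_class_def pushout_eq.refl)

lemma mult_cls:
  assumes "u \<in> W" "v \<in> W"
  shows "cls u \<otimes>\<^bsub>P\<^esub> cls v = cls (u @ v)"
proof -
  have "cls (u' @ v') = cls (u @ v)" if "u' \<in> cls u" "v' \<in> cls v" for u' v'
  proof -
    have "E (u @ v) (u' @ v')"
      using that by (auto simp: pushout_class_def intro: pushout_eq.append)
    moreover have "u @ v \<in> W"
      using assms by (simp add: pushout_words_def)
    ultimately show ?thesis
      using cls_eq_iff by blast
  qed
  moreover have "cls u \<noteq> {}" "cls v \<noteq> {}"
    using assms cls_self by blast+
  ultimately show ?thesis
    unfolding group_pushout_def monoid.simps by auto
qed

lemma carrier_pushout: "carrier P = cls ` W"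
  by (simp add: group_pushout_def)

lemma one_pushout: "\<one>\<^bsub>P\<^esub> = cls []"
  by (simp add: group_pushout_def)

lemma words_append: "u \<in> W \<Longrightarrow> v \<in> W \<Longrightarrow> u @ v \<in> W"
  by (simp add: pushout_words_def)

lemma words_Nil: "[] \<in> W"
  by (simp add: pushout_words_def)

lemma letter_inverse:
  assumes "s \<in> carrier G <+> carrier H"
  shows "\<exists>t \<in> carrier G <+> carrier H. E [t, s] []"
  using assms
proof
  fix a assume s: "s = Inl a" and a: "a \<in> carrier G"
  have "E [Inl (inv\<^bsub>G\<^esub> a), Inl a] [Inl \<one>\<^bsub>G\<^esub>]"
    using pushout_eq.mult_left[of "inv\<^bsub>G\<^esub> a" G a] a by simp
  then have "E [Inl (inv\<^bsub>G\<^esub> a), s] []"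
    unfolding s by (rule pushout_eq.trans[OF _ pushout_eq.one_left])
  with a show ?thesis
    by (intro bexI[of _ "Inl (inv\<^bsub>G\<^esub> a)"]) auto
next
  fix b assume s: "s = Inr b" and b: "b \<in> carrier H"
  have "E [Inr (inv\<^bsub>H\<^esub> b), Inr b] [Inr \<one>\<^bsub>H\<^esub>]"
    using pushout_eq.mult_right[of "inv\<^bsub>H\<^esub> b" H b] b by simp
  then have "E [Inr (inv\<^bsub>H\<^esub> b), s] []"
    unfolding s by (rule pushout_eq.trans[OF _ pushout_eq.one_right])
  with b show ?thesis
    by (intro bexI[of _ "Inr (inv\<^bsub>H\<^esub> b)"]) auto
qed

lemma word_inverse: "u \<in> W \<Longrightarrow> \<exists>v \<in> W. E (v @ u) []"
proof (induction u)
  case Nil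
  then show ?case
    by (metis append_Nil pushout_eq.refl)
next
  case (Cons s u)
  then have s: "s \<in> carrier G <+> carrier H" and u: "u \<in> W"
    by (auto simp: pushout_words_def)
  obtain v where v: "v \<in> W" "E (v @ u) []"
    using Cons u by blast
  obtain t where t: "t \<in> carrier G <+> carrier H" "E [t, s] []"
    using letter_inverse s by blast
  have "E ([t, s] @ u) ([] @ u)"
    using t(2) u by (blast intro: pushout_eq.append pushout_eq.refl)
  then have "E (v @ ([t, s] @ u)) (v @ ([] @ u))"
    using v(1) by (blast intro: pushout_eq.append pushout_eq.refl)
  then have "E ((v @ [t]) @ s # u) []"
    using v(2) pushout_eq.trans by fastforce
  moreover have "v @ [t] \<in> W"
    using v(1) t(1) by (simp add: pushout_words_def)
  ultimately show ?case by blast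
qed

lemma group_pushout: "group P"
proof (rule groupI)
  fix X Y Z assume X: "X \<in> carrier P" and Y: "Y \<in> carrier P" and Z: "Z \<in> carrier P"
  then obtain u v w where uvw: "u \<in> W" "v \<in> W" "w \<in> W" "X = cls u" "Y = cls v" "Z = cls w"
    unfolding carrier_pushout by blast
  then show "X \<otimes>\<^bsub>P\<^esub> Y \<otimes>\<^bsub>P\<^esub> Z = X \<otimes>\<^bsub>P\<^esub> (Y \<otimes>\<^bsub>P\<^esub> Z)"
    by (simp add: mult_cls words_append)
next
  fix X assume "X \<in> carrier P"
  then obtain u where u: "u \<in> W" "X = cls u"
    unfolding carrier_pushout by blast
  then show "\<one>\<^bsub>P\<^esub> \<otimes>\<^bsub>P\<^esub> X = X"
    by (simp add: mult_cls words_Nil one_pushout)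
  obtain v where v: "v \<in> W" "E (v @ u) []"
    using u word_inverse by blast
  then have "cls v \<otimes>\<^bsub>P\<^esub> X = \<one>\<^bsub>P\<^esub>"
    using u by (simp add: mult_cls one_pushout cls_eq_iff words_append)
  then show "\<exists>Y\<in>carrier P. Y \<otimes>\<^bsub>P\<^esub> X = \<one>\<^bsub>P\<^esub>"
    using v(1) carrier_pushout by blast
next
  fix X Y assume "X \<in> carrier P" "Y \<in> carrier P"
  then show "X \<otimes>\<^bsub>P\<^esub> Y \<in> carrier P"
    unfolding carrier_pushout using mult_cls words_append by force
next
  show "\<one>\<^bsub>P\<^esub> \<in> carrier P"
    unfolding carrier_pushout one_pushout using words_Nil by blast
qed

lemma Inl_word: "a \<in> carrier G \<Longrightarrow> [Inl a] \<in> W"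
  by (auto simp: pushout_words_def)

lemma Inr_word: "b \<in> carrier H \<Longrightarrow> [Inr b] \<in> W"
  by (auto simp: pushout_words_def)

lemma inl_hom: "inl \<in> hom G P"
proof (rule homI)
  fix a assume "a \<in> carrier G"
  then show "inl a \<in> carrier P"
    unfolding carrier_pushout pushout_inl_def using Inl_word by blast
next
  fix a a' assume a: "a \<in> carrier G" "a' \<in> carrier G"
  have "cls [Inl a, Inl a'] = cls [Inl (a \<otimes>\<^bsub>G\<^esub> a')]"
    using a by (subst cls_eq_iff) (auto simp: pushout_words_def intro: pushout_eq.mult_left)
  then show "inl (a \<otimes>\<^bsub>G\<^esub> a') = inl a \<otimes>\<^bsub>P\<^esub> inl a'"
    using a by (simp add: pushout_inl_def mult_cls Inl_word)
qed

lemma inr_hom: "inr \<in> hom H P"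
proof (rule homI)
  fix b assume "b \<in> carrier H"
  then show "inr b \<in> carrier P"
    unfolding carrier_pushout pushout_inr_def using Inr_word by blast
next
  fix b b' assume b: "b \<in> carrier H" "b' \<in> carrier H"
  have "cls [Inr b, Inr b'] = cls [Inr (b \<otimes>\<^bsub>H\<^esub> b')]"
    using b by (subst cls_eq_iff) (auto simp: pushout_words_def intro: pushout_eq.mult_right)
  then show "inr (b \<otimes>\<^bsub>H\<^esub> b') = inr b \<otimes>\<^bsub>P\<^esub> inr b'"
    using b by (simp add: pushout_inr_def mult_cls Inr_word)
qed

lemma pushout_commutes: "c \<in> carrier C \<Longrightarrow> inl (f c) = inr (g c)"
  unfolding pushout_inl_def pushout_inr_def
  by (subst cls_eq_iff) (auto simp: f_closed Inl_word intro: pushout_eq.glue)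

theorem pushout_universal:
  fixes K :: "('z, 'y) monoid_scheme"
  assumes K: "group K" and h: "h \<in> hom G K" and k: "k \<in> hom H K"
    and hk: "\<And>c. c \<in> carrier C \<Longrightarrow> h (f c) = k (g c)"
  shows "\<exists>\<phi> \<in> hom P K. (\<forall>a\<in>carrier G. \<phi> (inl a) = h a) \<and> (\<forall>b\<in>carrier H. \<phi> (inr b) = k b) \<and>
    (\<forall>\<psi> \<in> hom P K. (\<forall>a\<in>carrier G. \<psi> (inl a) = h a) \<and> (\<forall>b\<in>carrier H. \<psi> (inr b) = k b) \<longrightarrow>
       (\<forall>X\<in>carrier P. \<psi> X = \<phi> X))"
proof -
  interpret K: group K by fact
  define l where "l = case_sum h k"
  define ev where "ev u = foldr (\<lambda>s z. l s \<otimes>\<^bsub>K\<^esub> z) u \<one>\<^bsub>K\<^esub>" for u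
  have hc: "h a \<in> carrier K" if "a \<in> carrier G" for a
    using h that by (auto simp: hom_def)
  have kc: "k b \<in> carrier K" if "b \<in> carrier H" for b
    using k that by (auto simp: hom_def)
  have lc: "l s \<in> carrier K" if "s \<in> carrier G <+> carrier H" for s
    using that by (auto simp: l_def hc kc)
  have ev_Nil: "ev [] = \<one>\<^bsub>K\<^esub>" and ev_Cons: "ev (s # u) = l s \<otimes>\<^bsub>K\<^esub> ev u" for s u
    by (simp_all add: ev_def)
  have ev_closed: "ev u \<in> carrier K" if "u \<in> W" for u
    using that by (induction u) (auto simp: ev_Nil ev_Cons pushout_words_def lc)
  have ev_append: "ev (u @ v) = ev u \<otimes>\<^bsub>K\<^esub> ev v" if "u \<in> W" "v \<in> W" for u v
    using that(1)
  proof (induction u)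
    case Nil
    then show ?case using ev_closed[OF that(2)] by (simp add: ev_Nil)
  next
    case (Cons s u)
    then have "s \<in> carrier G <+> carrier H" "u \<in> W"
      by (auto simp: pushout_words_def)
    then show ?case
      using Cons ev_closed that(2) lc by (simp add: ev_Cons K.m_assoc)
  qed
  have ev_eq: "ev u = ev v" if "E u v" for u v
    using that
  proof (induction rule: pushout_eq.induct)
    case (append u u' v v')
    then show ?case using ev_append pushout_eq_words by metis
  next
    case one_left
    then show ?case using hom_one[OF h G.is_group K] by (simp add: ev_Nil ev_Cons l_def)
  next
    case one_right
    then show ?case using hom_one[OF k H.is_group K] by (simp add: ev_Nil ev_Cons l_def)
  next
    case (mult_left a a')
    then show ?case using hom_mult[OF h] hc by (simp add: ev_Nil ev_Cons l_def)
  next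
    case (mult_right b b')
    then show ?case using hom_mult[OF k] kc by (simp add: ev_Nil ev_Cons l_def)
  next
    case (glue c)
    then show ?case using hk by (simp add: ev_Cons l_def)
  qed auto
  define \<phi> where "\<phi> X = the_elem (ev ` X)" for X
  have \<phi>_cls: "\<phi> (cls u) = ev u" if "u \<in> W" for u
  proof -
    have "ev ` cls u = {ev u}"
      using that cls_self ev_eq by (fastforce simp: pushout_class_def)
    then show ?thesis by (simp add: \<phi>_def)
  qed
  have \<phi>_hom: "\<phi> \<in> hom P K"
    by (rule homI) (auto simp: carrier_pushout \<phi>_cls ev_closed mult_cls ev_append words_append)
  have \<phi>_inl: "\<phi> (inl a) = h a" if "a \<in> carrier G" for a
    using that by (simp add: pushout_inl_def \<phi>_cls Inl_word ev_Nil ev_Cons l_def hc)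
  have \<phi>_inr: "\<phi> (inr b) = k b" if "b \<in> carrier H" for b
    using that by (simp add: pushout_inr_def \<phi>_cls Inr_word ev_Nil ev_Cons l_def kc)
  have uniq: "\<psi> X = \<phi> X" if \<psi>: "\<psi> \<in> hom P K" and a: "\<forall>a\<in>carrier G. \<psi> (inl a) = h a"
    and b: "\<forall>b\<in>carrier H. \<psi> (inr b) = k b" and X: "X \<in> carrier P" for \<psi> X
  proof -
    have "\<psi> (cls u) = ev u" if "u \<in> W" for u
      using that
    proof (induction u)
      case Nil
      then show ?case using hom_one[OF \<psi> group_pushout K] by (simp add: one_pushout ev_Nil)
    next
      case (Cons s u)
      then have s: "s \<in> carrier G <+> carrier H" and u: "u \<in> W" and sW: "[s] \<in> W"
        by (auto simp: pushout_words_def)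
      have "\<psi> (cls [s]) = l s"
        using s a b by (auto simp: l_def pushout_inl_def pushout_inr_def)
      moreover have "\<psi> (cls (s # u)) = \<psi> (cls [s]) \<otimes>\<^bsub>K\<^esub> \<psi> (cls u)"
        using hom_mult[OF \<psi>, of "cls [s]" "cls u"] mult_cls[OF sW u] sW u
        by (simp add: carrier_pushout)
      ultimately show ?case using Cons u by (simp add: ev_Cons)
    qed
    then show ?thesis using X \<phi>_cls by (auto simp: carrier_pushout)
  qed
  show ?thesis
    using \<phi>_hom \<phi>_inl \<phi>_inr uniq by blast
qed

end

definition amalgam :: "('g, 'm) monoid_scheme \<Rightarrow> 'g set \<Rightarrow> ('g + 'g) list set monoid"
  where "amalgam S B = group_pushout (S\<lparr>carrier := B\<rparr>) S S (\<lambda>b. b) (\<lambda>b. b)"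

definition amalgam_base :: "('g, 'm) monoid_scheme \<Rightarrow> 'g set \<Rightarrow> 'g \<Rightarrow> ('g + 'g) list set"
  where "amalgam_base S B b = pushout_inl (S\<lparr>carrier := B\<rparr>) S S (\<lambda>b. b) (\<lambda>b. b) b"

lemma amalgam_data:
  assumes "group S" "subgroup B S"
  shows "group_pushout_data (S\<lparr>carrier := B\<rparr>) S S (\<lambda>b. b) (\<lambda>b. b)"
proof -
  have "group (S\<lparr>carrier := B\<rparr>)"
    using assms by (simp add: subgroup.subgroup_is_group)
  moreover have "(\<lambda>b. b) \<in> hom (S\<lparr>carrier := B\<rparr>) S"
    using subgroup.subset[OF assms(2)] by (auto simp: hom_def)
  ultimately show ?thesis
    using assms(1)
    by (simp add: group_pushout_data_def group_pushout_data_axioms_def)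
qed

lemma group_amalgam:
  assumes "group S" "subgroup B S"
  shows "group (amalgam S B)"
  using group_pushout_data.group_pushout[OF amalgam_data[OF assms]] by (simp add: amalgam_def)

lemma amalgam_base_eq_inr:
  assumes "group S" "subgroup B S" "b \<in> B"
  shows "amalgam_base S B b = pushout_inr (S\<lparr>carrier := B\<rparr>) S S (\<lambda>b. b) (\<lambda>b. b) b"
  using group_pushout_data.pushout_commutes[OF amalgam_data[OF assms(1,2)]] assms(3)
  by (simp add: amalgam_base_def)

lemma amalgam_base_hom:
  assumes "group S" "subgroup B S"
  shows "amalgam_base S B \<in> hom (S\<lparr>carrier := B\<rparr>) (amalgam S B)"
proof -
  have inl: "amalgam_base S B \<in> hom S (amalgam S B)"
    using group_pushout_data.inl_hom[OF amalgam_data[OF assms]]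
    unfolding amalgam_def amalgam_base_def[abs_def] .
  have "b \<in> carrier S" if "b \<in> B" for b
    using subgroup.subset[OF assms(2)] that by blast
  then show ?thesis
    using hom_in_carrier[OF inl] hom_mult[OF inl] by (intro homI) simp_all
qed

lemma amalgam_base_inj:
  assumes "group S" "subgroup B S"
  shows "inj_on (amalgam_base S B) B"
proof -
  have id: "(\<lambda>a. a) \<in> hom S S"
    by (simp add: hom_def)
  obtain \<phi> where \<phi>: "\<forall>a\<in>carrier S. \<phi> (amalgam_base S B a) = a"
    using group_pushout_data.pushout_universal[OF amalgam_data[OF assms] assms(1) id id HOL.refl]
    unfolding amalgam_base_def by (elim bexE conjE)
  show ?thesis
  proof (rule inj_on_inverseI[of _ \<phi>])
    show "\<phi> (amalgam_base S B b) = b" if "b \<in> B" for b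
      using \<phi> subgroup.subset[OF assms(2)] that by blast
  qed
qed

text \<open>
  Here the groups \<open>G\<close> and \<open>H\<close> contain \<open>B\<close> via the maps \<open>i\<close> and \<open>j\<close>, respectively.
\<close>

definition isomorphic_over ::
  "'b set \<Rightarrow> ('g, 'm) monoid_scheme \<Rightarrow> ('b \<Rightarrow> 'g) \<Rightarrow> ('h, 'n) monoid_scheme \<Rightarrow> ('b \<Rightarrow> 'h) \<Rightarrow> bool"
  where "isomorphic_over B G i H j \<longleftrightarrow> (\<exists>\<theta> \<in> iso G H. \<forall>b\<in>B. \<theta> (i b) = j b)"

end

(*
  The stabilizer B is a maximal proper subgroup of S.  An isomorphism over B from T to the amalgam
  would pull the first copy of S back to a subgroup strictly between B and T.  It is strictly larger
  than B because folding the two copies together retracts the amalgam onto S.  It is strictly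
  smaller than T because the two copies of S can act on the set obtained from Omega by
  doubling x, each of them fixing one of the two points over x: the two actions agree on B, and an
  element outside B of the second copy does not act like an element of the first.
*)

theory Submission
  imports Defs "HOL-Combinatorics.Transposition"
begin

section \<open>Permutation groups, and the action with one adjoined fixed point\<close>

lemma mult_BijGroup_apply:
  assumes "f \<in> carrier (BijGroup A)" "g \<in> carrier (BijGroup A)" "a \<in> A"
  shows "(f \<otimes>\<^bsub>BijGroup A\<^esub> g) a = f (g a)"
  using assms by (simp add: BijGroup_def compose_eq)

lemma carrier_BijGroup_mem:
  assumes "f \<in> carrier (BijGroup A)" "a \<in> A"
  shows "f a \<in> A"
  using assms by (auto simp: BijGroup_def Bij_def bij_betw_def)

lemma inv_BijGroup_apply:
  assumes "f \<in> carrier (BijGroup A)" "a \<in> A"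
  shows "(inv\<^bsub>BijGroup A\<^esub> f) (f a) = a"
proof -
  interpret group "BijGroup A" by (rule group_BijGroup)
  have "(inv\<^bsub>BijGroup A\<^esub> f) (f a) = (inv\<^bsub>BijGroup A\<^esub> f \<otimes>\<^bsub>BijGroup A\<^esub> f) a"
    by (rule mult_BijGroup_apply[symmetric]) (simp_all add: assms)
  also have "\<dots> = \<one>\<^bsub>BijGroup A\<^esub> a"
    using assms(1) by simp
  also have "\<dots> = a"
    using assms(2) by (simp add: BijGroup_def)
  finally show ?thesis .
qed

text \<open>Elements of \<open>BijGroup A\<close> are extensional, so a permutation enters the group
  only after being cut off to \<open>undefined\<close> outside \<open>A\<close>.\<close>

lemma restrict_BijGroup:
  assumes "bij_betw f A A"
  shows "restrict f A \<in> carrier (BijGroup A)"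
  using assms by (simp add: BijGroup_def Bij_def)

lemma restrict_transpose_BijGroup:
  assumes "a \<in> A" "b \<in> A"
  shows "restrict (transpose a b) A \<in> carrier (BijGroup A)"
  using assms by (intro restrict_BijGroup) (simp add: bij_betw_def transpose_image_eq)

text \<open>Here \<open>None\<close> is a point adjoined to \<open>A\<close>: it serves later as the
  second point over \<open>x\<close>, the first being \<open>Some x\<close>.\<close>

lemma restrict_map_option_BijGroup:
  assumes "s \<in> carrier (BijGroup A)"
  shows "restrict (map_option s) (insert None (Some ` A))
    \<in> carrier (BijGroup (insert None (Some ` A)))"
proof -
  have s: "inj_on s A" "s ` A = A"
    using assms by (auto simp: BijGroup_def Bij_def bij_betw_def)
  have "map_option s ` insert None (Some ` A) = insert None (Some ` s ` A)"
    by (simp add: image_image)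
  moreover have "inj_on (map_option s) (insert None (Some ` A))"
    using s(1) by (auto simp: inj_on_def)
  ultimately have "bij_betw (map_option s) (insert None (Some ` A)) (insert None (Some ` A))"
    using s(2) by (simp add: bij_betw_def)
  then show ?thesis by (rule restrict_BijGroup)
qed

lemma restrict_map_option_hom:
  "(\<lambda>s. restrict (map_option s) (insert None (Some ` A)))
    \<in> hom (BijGroup A) (BijGroup (insert None (Some ` A)))"
proof (rule homI)
  fix s t assume st: "s \<in> carrier (BijGroup A)" "t \<in> carrier (BijGroup A)"
  define A' where "A' = insert None (Some ` A)"
  \<comment> \<open>This keeps \<open>Some (t a)\<close> inside \<open>A'\<close>, where the
    restricted \<open>map_option s\<close> is not cut off to \<open>undefined\<close>.\<close>
  have "t a \<in> A" if "a \<in> A" for a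
    using that carrier_BijGroup_mem[OF st(2)] by blast
  then have "restrict (map_option (compose A s t)) A'
    = compose A' (restrict (map_option s) A') (restrict (map_option t) A')"
    by (auto simp: A'_def compose_def fun_eq_iff)
  then show "restrict (map_option (s \<otimes>\<^bsub>BijGroup A\<^esub> t)) (insert None (Some ` A))
    = restrict (map_option s) (insert None (Some ` A)) \<otimes>\<^bsub>BijGroup (insert None (Some ` A))\<^esub>
      restrict (map_option t) (insert None (Some ` A))"
    using st restrict_map_option_BijGroup[OF st(1)] restrict_map_option_BijGroup[OF st(2)]
    by (simp add: BijGroup_def A'_def)
qed (rule restrict_map_option_BijGroup)

section \<open>Point stabilizers and their maximality\<close>

lemma stabilizer_BijGroup_iff:
  "b \<in> stabilizer (BijGroup A) (\<lambda>\<sigma>. \<sigma>) x \<longleftrightarrow> b \<in> carrier (BijGroup A) \<and> b x = x"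
  by (auto simp: stabilizer_def)

lemma subgroup_stabilizer_BijGroup:
  assumes "x \<in> A"
  shows "subgroup (stabilizer (BijGroup A) (\<lambda>\<sigma>. \<sigma>) x) (BijGroup A)"
proof -
  interpret group "BijGroup A" by (rule group_BijGroup)
  show ?thesis
  proof (rule subgroupI)
    have "\<one>\<^bsub>BijGroup A\<^esub> \<in> stabilizer (BijGroup A) (\<lambda>\<sigma>. \<sigma>) x"
      unfolding stabilizer_BijGroup_iff using assms one_closed by (simp add: BijGroup_def)
    then show "stabilizer (BijGroup A) (\<lambda>\<sigma>. \<sigma>) x \<noteq> {}" by blast
  next
    fix b assume "b \<in> stabilizer (BijGroup A) (\<lambda>\<sigma>. \<sigma>) x"
    then show "inv\<^bsub>BijGroup A\<^esub> b \<in> stabilizer (BijGroup A) (\<lambda>\<sigma>. \<sigma>) x"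
      using inv_BijGroup_apply[of b A x] assms by (simp add: stabilizer_BijGroup_iff)
  qed (auto simp: stabilizer_BijGroup_iff mult_BijGroup_apply assms)
qed

text \<open>The permutations that move \<open>x\<close> form at most one double coset of the
  stabilizer: if \<open>u\<close> and \<open>s\<close> both move \<open>x\<close>, then
  \<open>s\<close> is the product of \<open>inv b\<close>, \<open>u\<close> and \<open>c\<close> for
  suitable \<open>b\<close> and \<open>c\<close> fixing \<open>x\<close>.\<close>

lemma stabilizer_BijGroup_maximal:
  assumes U: "subgroup U (BijGroup A)" and x: "x \<in> A"
    and BU: "stabilizer (BijGroup A) (\<lambda>\<sigma>. \<sigma>) x \<subset> U"
  shows "U = carrier (BijGroup A)"
proof -
  interpret group "BijGroup A" by (rule group_BijGroup)
  interpret U: subgroup U "BijGroup A" by fact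
  obtain u where u: "u \<in> U" "u \<notin> stabilizer (BijGroup A) (\<lambda>\<sigma>. \<sigma>) x"
    using BU by blast
  then have uS: "u \<in> carrier (BijGroup A)" and ux: "u x \<noteq> x"
    using U.subset by (auto simp: stabilizer_BijGroup_iff)
  have fix_x: "b \<in> U" if "b \<in> carrier (BijGroup A)" "b x = x" for b
    using BU that by (blast intro: stabilizer_BijGroup_iff[THEN iffD2])
  have "s \<in> U" if s: "s \<in> carrier (BijGroup A)" for s
  proof (cases "s x = x")
    case True
    with s show ?thesis by (rule fix_x)
  next
    case False
    \<comment> \<open>This carries \<open>s x\<close> to \<open>u x\<close> and fixes
      \<open>x\<close>, which differs from both. Hence \<open>b\<close> followed by the inverse of
      \<open>u\<close> brings \<open>s x\<close> back to \<open>x\<close>, so that \<open>c\<close>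
      below fixes \<open>x\<close>.\<close>
    define b where "b = restrict (transpose (s x) (u x)) A"
    have b: "b \<in> carrier (BijGroup A)"
      using carrier_BijGroup_mem[OF s x] carrier_BijGroup_mem[OF uS x]
      unfolding b_def by (rule restrict_transpose_BijGroup)
    have bU: "b \<in> U"
      using b by (rule fix_x) (use False ux x in \<open>simp add: b_def transpose_def\<close>)
    define c where "c = inv\<^bsub>BijGroup A\<^esub> u \<otimes>\<^bsub>BijGroup A\<^esub> (b \<otimes>\<^bsub>BijGroup A\<^esub> s)"
    have "b (s x) = u x"
      using carrier_BijGroup_mem[OF s x] by (simp add: b_def)
    then have "c x = x"
      using b s uS x by (simp add: c_def mult_BijGroup_apply inv_BijGroup_apply)
    then have "c \<in> U"
      using b s uS by (intro fix_x) (simp_all add: c_def)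
    then have "inv\<^bsub>BijGroup A\<^esub> b \<otimes>\<^bsub>BijGroup A\<^esub> (u \<otimes>\<^bsub>BijGroup A\<^esub> c) \<in> U"
      using bU u(1) by simp
    also have "inv\<^bsub>BijGroup A\<^esub> b \<otimes>\<^bsub>BijGroup A\<^esub> (u \<otimes>\<^bsub>BijGroup A\<^esub> c) = s"
      using b s uS by (simp add: c_def m_assoc[symmetric])
    finally show ?thesis .
  qed
  then show ?thesis using U.subset by blast
qed

section \<open>The two copies of \<open>S\<close> in the amalgam\<close>

lemma inl_eq_amalgam_base_imp:
  assumes "group S" "subgroup B S" "s \<in> carrier S" "b \<in> B"
    and "pushout_inl (S\<lparr>carrier := B\<rparr>) S S (\<lambda>b. b) (\<lambda>b. b) s = amalgam_base S B b"
  shows "s = b"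
proof -
  have id: "(\<lambda>a. a) \<in> hom S S"
    by (simp add: hom_def)
  \<comment> \<open>The folding map: the universal property applied to the identity on both copies.
    It is a left inverse of the embedding of the first copy.\<close>
  obtain \<phi> where "\<forall>a\<in>carrier S. \<phi> (amalgam_base S B a) = a"
    using group_pushout_data.pushout_universal[OF amalgam_data[OF assms(1,2)] assms(1) id id HOL.refl]
    unfolding amalgam_base_def by (elim bexE conjE)
  then show ?thesis
    using assms(3-5) subgroup.subset[OF assms(2)] unfolding amalgam_base_def by (metis subsetD)
qed

text \<open>The two copies meet only in the image of \<open>B\<close>. The actions \<open>h\<close>
  and \<open>k\<close> on the set with \<open>x\<close> doubled separate them: \<open>h t\<close>
  always fixes \<open>None\<close>, whereas \<open>k s\<close> moves it as soon as \<open>s\<close>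
  moves \<open>x\<close>.\<close>

lemma inr_neq_inl_BijGroup:
  fixes A :: "'a set" and x :: 'a
  defines "S \<equiv> BijGroup A"
  defines "B \<equiv> stabilizer S (\<lambda>\<sigma>. \<sigma>) x"
  assumes x: "x \<in> A" and s: "s \<in> carrier S" "s \<notin> B" and t: "t \<in> carrier S"
  shows "pushout_inr (S\<lparr>carrier := B\<rparr>) S S (\<lambda>b. b) (\<lambda>b. b) s
    \<noteq> pushout_inl (S\<lparr>carrier := B\<rparr>) S S (\<lambda>b. b) (\<lambda>b. b) t" (is "?inr s \<noteq> ?inl t")
proof
  assume eq: "?inr s = ?inl t"
  define A' where "A' = insert None (Some ` A)"
  define K where "K = BijGroup A'"
  define h where "h s = restrict (map_option s) A'" for s :: "'a \<Rightarrow> 'a"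
  \<comment> \<open>The swap of the two points over \<open>x\<close>. Conjugation by it turns
    \<open>h\<close>, which fixes \<open>None\<close>, into \<open>k\<close>, which fixes
    \<open>Some x\<close> and lets \<open>None\<close> play the role of \<open>x\<close>.\<close>
  define \<tau> where "\<tau> = restrict (transpose None (Some x)) A'"
  define k where "k s = \<tau> \<otimes>\<^bsub>K\<^esub> h s \<otimes>\<^bsub>K\<^esub> inv\<^bsub>K\<^esub> \<tau>" for s
  have S: "group S" and K: "group K"
    by (simp_all add: S_def K_def group_BijGroup)
  interpret K: group K by fact
  have B: "subgroup B S"
    unfolding B_def S_def using x by (rule subgroup_stabilizer_BijGroup)
  have h: "h \<in> hom S K"
    using restrict_map_option_hom[of A] by (simp add: S_def K_def A'_def h_def[abs_def])
  then have hc: "h s \<in> carrier K" if "s \<in> carrier S" for s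
    using that by (rule hom_in_carrier)
  have \<tau>: "\<tau> \<in> carrier K"
    unfolding \<tau>_def K_def using x by (intro restrict_transpose_BijGroup) (auto simp: A'_def)
  have k: "k \<in> hom S K"
  proof (rule homI)
    fix s t assume st: "s \<in> carrier S" "t \<in> carrier S"
    have "k s \<otimes>\<^bsub>K\<^esub> k t = \<tau> \<otimes>\<^bsub>K\<^esub> (h s \<otimes>\<^bsub>K\<^esub> (inv\<^bsub>K\<^esub> \<tau> \<otimes>\<^bsub>K\<^esub> \<tau>) \<otimes>\<^bsub>K\<^esub> h t) \<otimes>\<^bsub>K\<^esub> inv\<^bsub>K\<^esub> \<tau>"
      unfolding k_def using hc[OF st(1)] hc[OF st(2)] \<tau> by (simp only: K.m_assoc K.m_closed K.inv_closed)
    then show "k (s \<otimes>\<^bsub>S\<^esub> t) = k s \<otimes>\<^bsub>K\<^esub> k t"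
      using hc[OF st(1)] hc[OF st(2)] \<tau> hom_mult[OF h st] by (simp add: k_def)
  qed (use hc \<tau> in \<open>simp add: k_def\<close>)
  have apply_Some: "h s (Some a) = Some (s a)" if "a \<in> A" for s a
    using that by (simp add: h_def A'_def)
  have apply_None: "h s None = None" for s
    by (simp add: h_def A'_def)
  \<comment> \<open>An element of \<open>B\<close> fixes both points over \<open>x\<close> in the
    action \<open>h\<close> and permutes the remaining points among themselves, so
    \<open>h b\<close> commutes with \<tau>.\<close>
  have hk: "h b = k b" if "b \<in> B" for b
  proof -
    have b: "b \<in> carrier S" "b x = x"
      using that by (simp_all add: B_def S_def stabilizer_BijGroup_iff)
    have bA: "b a \<in> A" "b a = x \<longleftrightarrow> a = x" if "a \<in> A" for a
    proof -
      show "b a \<in> A"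
        using b(1) that unfolding S_def by (rule carrier_BijGroup_mem)
      show "b a = x \<longleftrightarrow> a = x"
        using inv_BijGroup_apply[of b A a] inv_BijGroup_apply[of b A x] b that x
        unfolding S_def by auto
    qed
    have "compose A' \<tau> (h b) = compose A' (h b) \<tau>"
      using bA x by (auto simp: b(2) compose_def fun_eq_iff \<tau>_def h_def A'_def transpose_def)
    then have "\<tau> \<otimes>\<^bsub>K\<^esub> h b = h b \<otimes>\<^bsub>K\<^esub> \<tau>"
      using hc[OF b(1)] \<tau> by (simp add: K_def BijGroup_def)
    then show ?thesis
      using hc[OF b(1)] \<tau> by (simp add: k_def K.m_assoc)
  qed
  obtain \<phi> where "\<forall>a\<in>carrier S. \<phi> (?inl a) = h a" "\<forall>a\<in>carrier S. \<phi> (?inr a) = k a"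
    using group_pushout_data.pushout_universal[OF amalgam_data[OF S B] K h k] hk by auto
  then have "h t = k s"
    using eq s t by metis
  then have "h t \<otimes>\<^bsub>K\<^esub> \<tau> = \<tau> \<otimes>\<^bsub>K\<^esub> h s"
    using \<tau> hc[OF s(1)] by (simp add: k_def K.m_assoc)
  \<comment> \<open>At \<open>Some x\<close> the left side is \<open>None\<close>, while the right
    side is \<open>Some (s x)\<close>, which \<tau> leaves alone because \<open>s x\<close> is
    neither \<open>None\<close> nor \<open>x\<close> in disguise.\<close>
  then have "(h t \<otimes>\<^bsub>K\<^esub> \<tau>) (Some x) = (\<tau> \<otimes>\<^bsub>K\<^esub> h s) (Some x)"
    by simp
  then have "h t (\<tau> (Some x)) = \<tau> (h s (Some x))"
    using \<tau> hc[OF s(1)] hc[OF t] x unfolding K_def by (simp add: mult_BijGroup_apply A'_def)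
  then have "None = \<tau> (Some (s x))"
    using x by (simp add: apply_Some apply_None \<tau>_def A'_def)
  moreover have "s x \<in> A" "s x \<noteq> x"
    using s carrier_BijGroup_mem[of s A x] x by (simp_all add: S_def B_def stabilizer_BijGroup_iff)
  ultimately show False
    by (simp add: \<tau>_def A'_def transpose_def)
qed

section \<open>Pulling the first copy of \<open>S\<close> back along the isomorphism\<close>

theorem mainTheorem9:
  fixes \<Omega> :: "'a set" and x :: 'a
    and S :: "('a \<Rightarrow> 'a) monoid" and B :: "('a \<Rightarrow> 'a) set"
  assumes "infinite \<Omega>" and "x \<in> \<Omega>"
    and "S = BijGroup \<Omega>"
    and "B = stabilizer S (\<lambda>\<sigma>. \<sigma>) x"
  shows "\<not> (\<exists>T. subgroup T S \<and> B \<subseteq> T \<and>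
    isomorphic_over B (S\<lparr>carrier := T\<rparr>) (\<lambda>b. b) (amalgam S B) (amalgam_base S B))"
proof
  assume "\<exists>T. subgroup T S \<and> B \<subseteq> T \<and>
    isomorphic_over B (S\<lparr>carrier := T\<rparr>) (\<lambda>b. b) (amalgam S B) (amalgam_base S B)"
  then obtain T \<theta> where T: "subgroup T S" "B \<subseteq> T" and \<theta>: "\<theta> \<in> iso (S\<lparr>carrier := T\<rparr>) (amalgam S B)"
    and \<theta>B: "\<And>b. b \<in> B \<Longrightarrow> \<theta> b = amalgam_base S B b"
    unfolding isomorphic_over_def by blast
  have S: "group S"
    using assms(3) by (simp add: group_BijGroup)
  have B: "subgroup B S"
    unfolding assms(3,4) using assms(2) by (rule subgroup_stabilizer_BijGroup)
  interpret S: group S by fact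
  interpret T: subgroup T S by fact
  interpret data: group_pushout_data "S\<lparr>carrier := B\<rparr>" S S "\<lambda>b. b" "\<lambda>b. b"
    using S B by (rule amalgam_data)
  interpret P: group "amalgam S B"
    using S B by (rule group_amalgam)
  interpret inl: group_hom S "amalgam S B" data.inl
    using data.inl_hom by unfold_locales (simp add: amalgam_def)
  have bij: "bij_betw \<theta> T (carrier (amalgam S B))" and hom: "\<theta> \<in> hom (S\<lparr>carrier := T\<rparr>) (amalgam S B)"
    using \<theta> by (simp_all add: iso_def)
  interpret \<theta>: group_hom "S\<lparr>carrier := T\<rparr>" "amalgam S B" \<theta>
    using hom T.subgroup_is_group[OF S] P.is_group by (simp add: group_hom_def group_hom_axioms_def)
  \<comment> \<open>The preimage under \<theta> of the first copy of \<open>S\<close>; maximality of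
    \<open>B\<close> is applied to it.\<close>
  define U where "U = {t \<in> T. \<theta> t \<in> data.inl ` carrier S}"
  have inl_subgroup: "subgroup (data.inl ` carrier S) (amalgam S B)"
    by (rule inl.img_is_subgroup)
  have U: "subgroup U S"
  proof (rule S.subgroupI)
    show "U \<subseteq> carrier S" by (auto simp: U_def)
    have "\<one>\<^bsub>S\<^esub> \<in> U"
      using \<theta>.hom_one subgroup.one_closed[OF inl_subgroup] by (simp add: U_def)
    then show "U \<noteq> {}" by blast
    show "inv\<^bsub>S\<^esub> u \<in> U" if "u \<in> U" for u
      using that \<theta>.hom_inv[of u] subgroup.m_inv_closed[OF inl_subgroup]
      by (simp add: U_def S.m_inv_consistent[OF T(1)])
    show "u \<otimes>\<^bsub>S\<^esub> v \<in> U" if "u \<in> U" "v \<in> U" for u v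
      using that \<theta>.hom_mult[of u v] subgroup.m_closed[OF inl_subgroup] by (simp add: U_def)
  qed
  \<comment> \<open>A second point yields a transposition \<open>s\<close> outside \<open>B\<close>,
    which is tested in the first copy to get \<open>U\<close> different from \<open>B\<close> and in
    the second to reach the contradiction.\<close>
  obtain y where y: "y \<in> \<Omega>" "y \<noteq> x"
    using infinite_imp_nonempty[OF infinite_remove[OF assms(1), of x]] by blast
  define s where "s = restrict (transpose x y) \<Omega>"
  have s: "s \<in> carrier S" "s \<notin> B"
    using y assms(2) by (simp_all add: s_def assms(3,4) restrict_transpose_BijGroup stabilizer_BijGroup_iff)
  have "B \<subseteq> U"
  proof
    fix b assume "b \<in> B"
    then have "b \<in> T" "b \<in> carrier S" "\<theta> b = data.inl b"
      using T(2) subgroup.subset[OF B] \<theta>B[of b] by (auto simp: amalgam_base_def)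
    then show "b \<in> U" by (simp add: U_def)
  qed
  moreover have "U \<noteq> B"
  \<comment> \<open>If \<open>U\<close> were \<open>B\<close>, the preimage of
    \<open>data.inl s\<close> would lie in \<open>B\<close>, where \<theta> is the base map; folding
    then gives that \<open>s\<close> itself lies in \<open>B\<close>.\<close>
  proof
    assume UB: "U = B"
    have "data.inl s \<in> \<theta> ` T"
      using inl.hom_closed[OF s(1)] bij_betw_imp_surj_on[OF bij] by simp
    then obtain t where t: "t \<in> T" "\<theta> t = data.inl s" by force
    then have "t \<in> U"
      using s(1) by (simp add: U_def)
    then have "t \<in> B" "data.inl s = amalgam_base S B t"
      using UB t(2) \<theta>B[of t] by auto
    then show False
      using inl_eq_amalgam_base_imp[OF S B s(1)] s(2) by blast
  qed
  ultimately have "B \<subset> U" by blast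
  then have U_eq: "U = carrier S"
    using stabilizer_BijGroup_maximal[of U \<Omega> x] U assms(2) unfolding assms(3,4) by blast
  \<comment> \<open>Now \<open>U\<close> is all of \<open>S\<close>, so \<theta> maps the whole of
    \<open>T\<close> into the first copy, yet it also attains \<open>data.inr s\<close>.\<close>
  have "data.inr s \<in> \<theta> ` T"
    using hom_in_carrier[OF data.inr_hom s(1)] bij_betw_imp_surj_on[OF bij]
    by (simp add: amalgam_def)
  then obtain t where t: "t \<in> T" "\<theta> t = data.inr s" by force
  have "t \<in> U"
    unfolding U_eq using T.subset t(1) by (rule subsetD)
  then have "data.inr s \<in> data.inl ` carrier S"
    unfolding U_def t(2)[symmetric] by simp
  then obtain r where r: "data.inr s = data.inl r" "r \<in> carrier S" by (rule imageE)
  have "data.inr s \<noteq> data.inl r"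
    using assms(2) s r(2) unfolding assms(3,4) by (rule inr_neq_inl_BijGroup)
  then show False using r(1) by (rule notE)
qed

end
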